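(* Let $D$ be a sink-free digraph which has no induced subdigraph isomorphic to $\vec{K}_{4,1}$ and no induced subdigraph isomorphic to $\vec{K}_{4,1}^+$. Then $D$ has a quasi-kernel of size at most $|V(D)|/2$.
   Context: A quasi-kernel of a digraph $D$ is an independent set $Q\subseteq V(D)$ such that for every vertex $v\in V(D)\setminus Q$ there is a directed path with one or two arcs from $v$ to some vertex of $Q$. A sink is a vertex with no out-neighbour; $D$ is sink-free if it has no sink. $\vec{K}_{4,1}$ is the digraph on five vertices $a_1,a_2,a_3,a_4,c$ whose arcs are exactly $a_1c,a_2c,a_3c,a_4c$. $\vec{K}_{4,1}^+$ is the digraph obtained from $\vec{K}_{4,1}$ by adding exactly one arc between two of the vertices $a_i$ (say the arc $a_1a_2$). *)

theory Defs
  imports Complex_Main "Graph_Theory.Graph_Theory"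
begin

definition sink :: "('a,'b) pre_digraph \<Rightarrow> 'a \<Rightarrow> bool" where
  "sink D v \<longleftrightarrow> v \<in> verts D \<and> \<not> (\<exists>w \<in> verts D. v \<rightarrow>\<^bsub>D\<^esub> w)"

definition sink_free :: "('a,'b) pre_digraph \<Rightarrow> bool" where
  "sink_free D \<longleftrightarrow> \<not> (\<exists>v. sink D v)"

definition independent_set :: "('a,'b) pre_digraph \<Rightarrow> 'a set \<Rightarrow> bool" where
  "independent_set D Q \<longleftrightarrow> Q \<subseteq> verts D \<and> (\<forall>u \<in> Q. \<forall>v \<in> Q. \<not> u \<rightarrow>\<^bsub>D\<^esub> v)"

text \<open>A path is represented by its list of arcs, so its length is the number of arcs.\<close>

definition quasi_kernel :: "('a,'b) pre_digraph \<Rightarrow> 'a set \<Rightarrow> bool" where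
  "quasi_kernel D Q \<longleftrightarrow> independent_set D Q \<and>
     (\<forall>v \<in> verts D - Q. \<exists>u \<in> Q. \<exists>p. pre_digraph.apath D v p u \<and> (length p = 1 \<or> length p = 2))"

text \<open>The centre \<open>c\<close> is \<open>0\<close>, and \<open>a\<^sub>i\<close> is \<open>i\<close> for \<open>i = 1, 2, 3, 4\<close>.\<close>

definition K41 :: "(nat, nat \<times> nat) pre_digraph" where
  "K41 = with_proj \<lparr> pverts = {0, 1, 2, 3, 4}, parcs = {(1, 0), (2, 0), (3, 0), (4, 0)} \<rparr>"

definition K41_plus :: "(nat, nat \<times> nat) pre_digraph" where
  "K41_plus = pre_digraph.add_arc K41 (1, 2)"

lemma K41_plus_eq:
  "K41_plus = with_proj \<lparr> pverts = {0, 1, 2, 3, 4},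
                          parcs = {(1, 2), (1, 0), (2, 0), (3, 0), (4, 0)} \<rparr>"
  by (auto simp: K41_plus_def K41_def pre_digraph.add_arc_def with_proj_def)

definition induced_free :: "('a,'b) pre_digraph \<Rightarrow> ('c,'d) pre_digraph \<Rightarrow> bool" where
  "induced_free D F \<longleftrightarrow> \<not> (\<exists>H. induced_subgraph H D \<and> digraph_iso H F)"

end

theory Submission
  imports Defs
begin

text \<open>
  Let \<open>Q\<close> be a minimum quasi-kernel, \<open>W\<^sub>1\<close> the in-neighbours of \<open>Q\<close> and \<open>W\<^sub>2\<close> the remaining
  vertices outside \<open>Q\<close>. Choose \<open>S \<subseteq> Q\<close> with \<open>|S| \<le> |W\<^sub>1|\<close> dominating \<open>W\<^sub>1\<close> and put
  \<open>R = Q - S\<close>. Let \<open>T\<close> be a quasi-kernel of the subdigraph induced by \<open>W\<^sub>2\<close> that is maximal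
  independent there. Deleting from \<open>S\<close> the vertices with an arc to \<open>T\<close>, and from \<open>R\<close> the
  vertices within distance two of \<open>T\<close>, leaves \<open>S'\<close> and \<open>R'\<close> such that \<open>T \<union> S' \<union> R'\<close> is again
  a quasi-kernel. If \<open>w \<in> W\<^sub>2 - T\<close> had two in-neighbours in \<open>R'\<close>, it would also have one in
  \<open>S\<close> (otherwise exchanging its in-neighbours in \<open>Q\<close> for \<open>w\<close> would shrink \<open>Q\<close>) and one in \<open>T\<close>,
  and these four in-neighbours would form one of the two forbidden subdigraphs with \<open>w\<close>.
  So \<open>|R'| \<le> |W\<^sub>2 - T|\<close>, and minimality gives
  \<open>|Q| \<le> |T| + |R'| + |S'| \<le> |W\<^sub>2| + |W\<^sub>1| = |V| - |Q|\<close>.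
\<close>

section \<open>Quasi-kernels of a relation on a finite vertex set\<close>

text \<open>With the carrier as a parameter, passing to an induced subdigraph only changes
  \<open>V\<close>. The intermediate vertex must then lie in the smaller set too.\<close>

definition quasi_kernel_on :: "('a \<Rightarrow> 'a \<Rightarrow> bool) \<Rightarrow> 'a set \<Rightarrow> 'a set \<Rightarrow> bool" where
  "quasi_kernel_on E V Q \<longleftrightarrow> Q \<subseteq> V \<and> (\<forall>u\<in>Q. \<forall>v\<in>Q. \<not> E u v) \<and>
     (\<forall>v\<in>V - Q. \<exists>u\<in>Q. E v u \<or> (\<exists>x\<in>V. E v x \<and> E x u))"

text \<open>Chvatal-Lovasz induction: remove a vertex \<open>v\<close> with its in-neighbours and
  take \<open>Q\<close> for the rest. If \<open>v\<close> has an arc into \<open>Q\<close>, the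
  in-neighbours reach \<open>Q\<close> through \<open>v\<close>; otherwise \<open>v\<close> can be
  added to \<open>Q\<close>.\<close>

lemma quasi_kernel_on_exists:
  assumes "finite V" and "\<forall>v\<in>V. \<not> E v v"
  shows "\<exists>Q. quasi_kernel_on E V Q"
  using assms
proof (induction V rule: finite_psubset_induct)
  case (psubset V)
  show ?case
  proof (cases "V = {}")
    case True
    then show ?thesis by (auto simp: quasi_kernel_on_def)
  next
    case False
    then obtain v where v: "v \<in> V" by blast
    define V' where "V' = {x \<in> V. x \<noteq> v \<and> \<not> E x v}"
    have "V' \<subset> V" using v by (auto simp: V'_def)
    then obtain Q where Q: "quasi_kernel_on E V' Q"
      using psubset.IH[of V'] psubset.prems by blast
    show ?thesis
    proof (cases "\<exists>q\<in>Q. E v q")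
      case True
      then have "quasi_kernel_on E V Q"
        using Q v unfolding quasi_kernel_on_def V'_def by blast
      then show ?thesis ..
    next
      case False
      then have "quasi_kernel_on E V (insert v Q)"
        using Q v psubset.prems unfolding quasi_kernel_on_def V'_def by blast
      then show ?thesis ..
    qed
  qed
qed

text \<open>Adding a vertex not adjacent to \<open>Q\<close> preserves the quasi-kernel property, so
  a quasi-kernel of largest size admits no such vertex.\<close>

lemma maximal_quasi_kernel_on_exists:
  assumes "finite V" and "\<forall>v\<in>V. \<not> E v v"
  obtains Q where "quasi_kernel_on E V Q" and "\<And>w. w \<in> V - Q \<Longrightarrow> \<exists>q\<in>Q. E w q \<or> E q w"
proof -
  obtain Q0 where "quasi_kernel_on E V Q0"
    using quasi_kernel_on_exists[where E = E, OF assms] by blast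
  moreover have "\<forall>Q. quasi_kernel_on E V Q \<longrightarrow> card Q < Suc (card V)"
    using assms(1) by (auto simp: quasi_kernel_on_def less_Suc_eq_le intro: card_mono)
  ultimately obtain Q where Q: "quasi_kernel_on E V Q"
    and max: "\<And>Q'. quasi_kernel_on E V Q' \<Longrightarrow> card Q' \<le> card Q"
    using ex_has_greatest_nat[of "quasi_kernel_on E V" Q0 card "Suc (card V)"] by blast
  have "\<exists>q\<in>Q. E w q \<or> E q w" if w: "w \<in> V - Q" for w
  proof (rule ccontr)
    assume "\<not> ?thesis"
    then have "quasi_kernel_on E V (insert w Q)"
      using Q w assms(2) unfolding quasi_kernel_on_def by blast
    moreover have "finite Q"
      using Q assms(1) by (auto simp: quasi_kernel_on_def intro: finite_subset)
    ultimately show False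
      using max[of "insert w Q"] w by simp
  qed
  with Q show ?thesis using that by blast
qed

section \<open>The exchange and counting argument\<close>

locale sink_free_no_in_claw =
  fixes E :: "'a \<Rightarrow> 'a \<Rightarrow> bool" and V :: "'a set"
  assumes finite_V: "finite V"
    and irrefl: "\<forall>v\<in>V. \<not> E v v"
    and out_neighbour: "v \<in> V \<Longrightarrow> \<exists>w\<in>V. E v w"
    and no_K41: "\<lbrakk>{c, a1, a2, a3, a4} \<subseteq> V; distinct [c, a1, a2, a3, a4];
      \<forall>x\<in>{a1, a2, a3, a4}. E x c \<and> \<not> E c x;
      \<forall>x\<in>{a1, a2, a3, a4}. \<forall>y\<in>{a1, a2, a3, a4}. \<not> E x y\<rbrakk> \<Longrightarrow> False"
    and no_K41_plus: "\<lbrakk>{c, a1, a2, a3, a4} \<subseteq> V; distinct [c, a1, a2, a3, a4];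
      \<forall>x\<in>{a1, a2, a3, a4}. E x c \<and> \<not> E c x;
      \<forall>x\<in>{a1, a2, a3, a4}. \<forall>y\<in>{a1, a2, a3, a4}. E x y \<longleftrightarrow> x = a1 \<and> y = a2\<rbrakk> \<Longrightarrow> False"
begin

lemma small_quasi_kernel:
  "\<exists>Q. quasi_kernel_on E V Q \<and> 2 * card Q \<le> card V"
proof -
  obtain Q where Q: "quasi_kernel_on E V Q"
    and min: "\<And>Q'. quasi_kernel_on E V Q' \<Longrightarrow> card Q \<le> card Q'"
    using quasi_kernel_on_exists[where E = E, OF finite_V irrefl]
      ex_has_least_nat[of "quasi_kernel_on E V" _ card] by blast
  define W1 where "W1 = {v \<in> V - Q. \<exists>q\<in>Q. E v q}"
  define W2 where "W2 = V - Q - W1"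
  have QV: "Q \<subseteq> V" and Q_ind: "\<And>u v. u \<in> Q \<Longrightarrow> v \<in> Q \<Longrightarrow> \<not> E u v"
    using Q by (auto simp: quasi_kernel_on_def)
  have fin: "finite Q" "finite W1" "finite W2"
    using finite_V QV by (auto simp: W1_def W2_def intro: finite_subset)
  have W2_Q: "\<And>w q. w \<in> W2 \<Longrightarrow> q \<in> Q \<Longrightarrow> \<not> E w q"
    by (auto simp: W1_def W2_def)
  have W2_W1: "\<And>w. w \<in> W2 \<Longrightarrow> \<exists>x\<in>W1. E w x"
  proof -
    fix w assume w: "w \<in> W2"
    then have "w \<in> V - Q" by (simp add: W2_def)
    then obtain u x where "u \<in> Q" "x \<in> V" "E w x" "E x u"
      using Q W2_Q[OF w] unfolding quasi_kernel_on_def by blast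
    then show "\<exists>x\<in>W1. E w x"
      using Q_ind W2_Q[OF w] by (auto simp: W1_def)
  qed
  have "\<forall>w\<in>W1. \<exists>q. q \<in> Q \<and> E w q" by (auto simp: W1_def)
  then obtain g where g: "\<And>w. w \<in> W1 \<Longrightarrow> g w \<in> Q \<and> E w (g w)" by metis
  define S where "S = g ` W1"
  have SQ: "S \<subseteq> Q" and W1_S: "\<And>w. w \<in> W1 \<Longrightarrow> \<exists>s\<in>S. E w s"
    and card_S: "card S \<le> card W1"
    using g fin(2) by (auto simp: S_def card_image_le)
  define R where "R = Q - S"
  have part: "V = Q \<union> W1 \<union> W2" "Q \<inter> W1 = {}" "(Q \<union> W1) \<inter> W2 = {}"
    using QV by (auto simp: W1_def W2_def)
  have Q_SR: "Q = S \<union> R" "S \<inter> R = {}" using SQ by (auto simp: R_def)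
  \<comment> \<open>If \<open>r\<close> had an arc into \<open>W1\<close>, it would reach
    \<open>S\<close> in two steps. As \<open>S\<close> alone already serves \<open>W1\<close> and
    \<open>W2\<close>, dropping \<open>r\<close> would contradict minimality.\<close>
  have R_W2: "w \<in> W2" if r: "r \<in> R" and w: "w \<in> V" and rw: "E r w" for r w
  proof (rule ccontr)
    assume "w \<notin> W2"
    then have "w \<in> W1" using w rw r Q_ind part(1) by (auto simp: R_def)
    have "quasi_kernel_on E V (Q - {r})"
      unfolding quasi_kernel_on_def
    proof (intro conjI ballI)
      fix v assume "v \<in> V - (Q - {r})"
      then consider "v = r" | "v \<in> W1" | "v \<in> W2" by (auto simp: part(1))
      then show "\<exists>u\<in>Q - {r}. E v u \<or> (\<exists>x\<in>V. E v x \<and> E x u)"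
      proof cases
        case 1
        obtain s where "s \<in> S" "E w s" using W1_S \<open>w \<in> W1\<close> by blast
        then show ?thesis using 1 rw r w SQ by (auto simp: R_def)
      next
        case 2
        then obtain s where "s \<in> S" "E v s" using W1_S by blast
        then show ?thesis using r SQ by (auto simp: R_def)
      next
        case 3
        then obtain x where x: "x \<in> W1" "E v x" using W2_W1 by blast
        moreover from this obtain s where "s \<in> S" "E x s" using W1_S by blast
        ultimately show ?thesis using r SQ part(1) by (auto simp: R_def)
      qed
    qed (use QV Q_ind in auto)
    then show False
      using min[of "Q - {r}"] r fin(1) card_Diff1_less[of Q r] by (auto simp: R_def)
  qed
  \<comment> \<open>If no vertex of \<open>S\<close> has an arc to \<open>w\<close>, the exchange
    keeps all of \<open>S\<close>, which still serves \<open>W1\<close> and \<open>W2\<close>, and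
    the deleted vertices have arcs to \<open>w\<close>. At least two vertices leave and one
    enters.\<close>
  have fork: "\<exists>s\<in>S. E s w"
    if w: "w \<in> W2" and r: "r1 \<in> R" "r2 \<in> R" "r1 \<noteq> r2" "E r1 w" "E r2 w" for w r1 r2
  proof (rule ccontr)
    assume noS: "\<not> ?thesis"
    define Q' where "Q' = insert w (Q - {r. E r w})"
    have wV: "w \<in> V" using w part(1) by blast
    have "quasi_kernel_on E V Q'"
      unfolding quasi_kernel_on_def
    proof (intro conjI ballI)
      fix v assume "v \<in> V - Q'"
      then consider "E v w" | "v \<in> W1" | "v \<in> W2" by (auto simp: part(1) Q'_def)
      moreover have "S \<subseteq> Q'" using noS SQ by (auto simp: Q'_def)
      moreover have "w \<in> Q'" by (simp add: Q'_def)
      ultimately show "\<exists>u\<in>Q'. E v u \<or> (\<exists>x\<in>V. E v x \<and> E x u)"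
        using W1_S W2_W1 part(1) by cases blast+
    next
      fix u v assume "u \<in> Q'" "v \<in> Q'"
      then show "\<not> E u v"
        using Q_ind W2_Q[OF w] irrefl wV by (auto simp: Q'_def)
    qed (use QV wV in \<open>auto simp: Q'_def\<close>)
    then have "card Q \<le> card Q'" by (rule min)
    also have "\<dots> \<le> Suc (card (Q - {r. E r w}))"
      by (simp add: Q'_def card_insert_if fin)
    also have "card (Q - {r. E r w}) \<le> card (Q - {r1, r2})"
      using r fin(1) by (intro card_mono) auto
    also have "card (Q - {r1, r2}) = card Q - 2"
      using r fin(1) by (subst card_Diff_subset) (auto simp: R_def)
    \<comment> \<open>Guards against truncated subtraction in \<open>card Q - 2\<close>.\<close>
    moreover have "card {r1, r2} \<le> card Q"
      using r fin(1) by (intro card_mono) (auto simp: R_def)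
    ultimately show False using r(3) by simp
  qed
  have "finite W2" "\<forall>v\<in>W2. \<not> E v v"
    using fin irrefl part(1) by auto
  then obtain T where T: "quasi_kernel_on E W2 T"
    and T_max: "\<And>w. w \<in> W2 - T \<Longrightarrow> \<exists>t\<in>T. E w t \<or> E t w"
    by (rule maximal_quasi_kernel_on_exists[where E = E]) blast
  have TW2: "T \<subseteq> W2" using T by (simp add: quasi_kernel_on_def)
  define S' where "S' = {s \<in> S. \<not> (\<exists>t\<in>T. E s t)}"
  \<comment> \<open>The intermediate vertex ranges over all of \<open>V\<close>: this later shows
    that an out-neighbour of a vertex of \<open>R'\<close> has no arc into \<open>T\<close>.\<close>
  define R' where "R' = {r \<in> R. \<not> (\<exists>t\<in>T. E r t \<or> (\<exists>x\<in>V. E r x \<and> E x t))}"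
  have "quasi_kernel_on E V (T \<union> S' \<union> R')"
    unfolding quasi_kernel_on_def
  proof (intro conjI ballI)
    fix v assume v: "v \<in> V - (T \<union> S' \<union> R')"
    then consider "v \<in> S" | "v \<in> R" | "v \<in> W1" | "v \<in> W2 - T"
      by (auto simp: part(1) Q_SR(1))
    then show "\<exists>u\<in>T \<union> S' \<union> R'. E v u \<or> (\<exists>x\<in>V. E v x \<and> E x u)"
    proof cases
      case 1
      then show ?thesis using v by (auto simp: S'_def)
    next
      case 2
      then show ?thesis using v by (auto simp: R'_def)
    next
      case 3
      then obtain s where s: "s \<in> S" "E v s" using W1_S by blast
      moreover have "s \<in> V" using s SQ QV by auto
      \<comment> \<open>A vertex \<open>s\<close> deleted from \<open>S\<close> has an arc into
        \<open>T\<close>, so \<open>v\<close> reaches \<open>T\<close> through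
        \<open>s\<close>.\<close>
      ultimately show ?thesis by (cases "s \<in> S'") (auto simp: S'_def)
    next
      case 4
      then show ?thesis using T part(1) unfolding quasi_kernel_on_def by blast
    qed
  next
    fix u v assume "u \<in> T \<union> S' \<union> R'" "v \<in> T \<union> S' \<union> R'"
    moreover have "S' \<subseteq> Q" "R' \<subseteq> Q" by (auto simp: S'_def R'_def Q_SR(1))
    moreover have "\<forall>u\<in>T. \<forall>v\<in>T. \<not> E u v" using T by (simp add: quasi_kernel_on_def)
    moreover have "\<forall>u\<in>T. \<forall>v\<in>Q. \<not> E u v" using TW2 W2_Q by blast
    moreover have "\<forall>u\<in>S' \<union> R'. \<forall>v\<in>T. \<not> E u v" by (auto simp: S'_def R'_def)
    ultimately show "\<not> E u v" using Q_ind by blast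
  next
    show "T \<union> S' \<union> R' \<subseteq> V"
      using TW2 by (auto simp: part(1) Q_SR(1) S'_def R'_def)
  qed
  then have "card Q \<le> card (T \<union> S' \<union> R')" by (rule min)
  also have "\<dots> \<le> card T + card S' + card R'"
    by (metis card_Un_le add_le_mono1 le_trans)
  finally have card_Q: "card Q \<le> card T + card S' + card R'" .
  \<comment> \<open>Sink-freeness supplies an out-neighbour; it lies in \<open>W2\<close> by
    \<open>R_W2\<close>, and outside \<open>T\<close> by the choice of \<open>R'\<close>.\<close>
  have "\<exists>w\<in>W2 - T. E r w" if r: "r \<in> R'" for r
  proof -
    have "r \<in> R" "r \<in> V" using r QV by (auto simp: R'_def R_def)
    then obtain w where "w \<in> W2" "E r w"
      using out_neighbour[of r] R_W2 by blast
    moreover from this have "w \<notin> T" using r by (auto simp: R'_def)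
    ultimately show ?thesis by blast
  qed
  then obtain f where f: "\<And>r. r \<in> R' \<Longrightarrow> f r \<in> W2 - T" "\<And>r. r \<in> R' \<Longrightarrow> E r (f r)"
    by metis
  have "inj_on f R'"
  proof (rule inj_onI, rule ccontr)
    fix r1 r2 assume r: "r1 \<in> R'" "r2 \<in> R'" "f r1 = f r2" "r1 \<noteq> r2"
    define w where "w = f r1"
    have w: "w \<in> W2 - T" "E r1 w" "E r2 w" using f[of r1] f[of r2] r by (auto simp: w_def)
    have rR: "r1 \<in> R" "r2 \<in> R" using r by (auto simp: R'_def)
    obtain s where s: "s \<in> S" "E s w" using fork[of w r1 r2] w r rR by auto
    have wV: "w \<in> V" using w part(1) by blast
    have "\<not> E w t" if "t \<in> T" for t
      using r(1) w(2) wV that by (auto simp: R'_def)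
    \<comment> \<open>Maximality of \<open>T\<close> makes \<open>w\<close> adjacent to some
      \<open>t\<close>, and the arc can only point to \<open>w\<close>.\<close>
    then obtain t where t: "t \<in> T" "E t w" "\<not> E w t"
      using T_max[OF w(1)] by blast
    have inQ: "r1 \<in> Q" "r2 \<in> Q" "s \<in> Q" using rR s Q_SR by auto
    have tW2: "t \<in> W2" using t TW2 by blast
    have sub: "{w, s, t, r1, r2} \<subseteq> V" using inQ QV wV tW2 part(1) by auto
    have dist: "distinct [w, s, t, r1, r2]"
      using inQ w tW2 t part rR s Q_SR(2) r(4) by auto
    have into: "\<forall>x\<in>{s, t, r1, r2}. E x w \<and> \<not> E w x"
      using s t w W2_Q inQ by auto
    \<comment> \<open>Together with the independence of \<open>Q\<close>, this leaves
      \<open>s\<close> to \<open>t\<close> as the only possible arc among the four in-neighbours;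
      its presence decides which forbidden subdigraph occurs.\<close>
    have arcs: "\<not> E r1 t" "\<not> E r2 t" "\<not> E t t" "\<And>q. q \<in> Q \<Longrightarrow> \<not> E t q"
      using r t irrefl sub W2_Q[OF tW2] by (auto simp: R'_def)
    show False
    proof (cases "E s t")
      case True
      have "\<forall>x\<in>{s, t, r1, r2}. \<forall>y\<in>{s, t, r1, r2}. E x y \<longleftrightarrow> x = s \<and> y = t"
        using True arcs inQ Q_ind dist by auto
      then show False by (rule no_K41_plus[OF sub dist into])
    next
      case False
      have "\<forall>x\<in>{s, t, r1, r2}. \<forall>y\<in>{s, t, r1, r2}. \<not> E x y"
        using False arcs inQ Q_ind by auto
      then show False by (rule no_K41[OF sub dist into])
    qed
  qed
  then have "card R' \<le> card (W2 - T)"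
    using f fin(3) by (intro card_inj_on_le[of f]) auto
  also have "\<dots> = card W2 - card T"
    using TW2 fin(3) by (simp add: card_Diff_subset finite_subset)
  finally have "card T + card R' \<le> card W2"
    using card_mono[OF fin(3) TW2] by simp
  moreover have "card S' \<le> card S"
    using SQ fin(1) by (intro card_mono) (auto simp: S'_def intro: finite_subset)
  moreover have "card V = card Q + card W1 + card W2"
    using part fin by (simp add: card_Un_disjoint)
  ultimately have "2 * card Q \<le> card V" using card_Q card_S by simp
  with Q show ?thesis by blast
qed

end

section \<open>Transfer to digraphs with explicit arcs\<close>

text \<open>Each arc is sent to the pair of images of its ends. This is injective because there are
  no parallel arcs and \<open>f\<close> is injective on \<open>X\<close>.\<close>

lemma (in digraph) induced_iso_with_proj:
  assumes "X \<subseteq> verts G" and "inj_on f X" and "f ` X = pverts P"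
    and "parcs P \<subseteq> pverts P \<times> pverts P"
    and arcs_iff: "\<forall>u\<in>X. \<forall>v\<in>X. u \<rightarrow> v \<longleftrightarrow> (f u, f v) \<in> parcs P"
  shows "digraph_iso (G \<restriction> X) (with_proj P)"
proof -
  interpret H: pre_digraph "G \<restriction> X" .
  define h where "h = \<lparr>iso_verts = f, iso_arcs = (\<lambda>e. (f (tail G e), f (head G e))),
    iso_head = snd, iso_tail = fst\<rparr>"
  have "inj_on (iso_arcs h) (arcs (G \<restriction> X))"
    using assms(2) by (auto simp: h_def inj_on_def arc_to_ends_def intro!: no_multi_arcs)
  then have "H.digraph_isomorphism h"
    using assms(2) by (auto simp: H.digraph_isomorphism_def h_def)
  moreover have "iso_arcs h ` arcs (G \<restriction> X) = parcs P"
  proof (intro equalityI subsetI)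
    fix e assume "e \<in> iso_arcs h ` arcs (G \<restriction> X)"
    then show "e \<in> parcs P"
      using arcs_iff by (auto simp: h_def arcs_ends_def arc_to_ends_def)
  next
    fix e assume e: "e \<in> parcs P"
    then obtain u v where uv: "u \<in> X" "v \<in> X" "e = (f u, f v)"
    proof -
      obtain a b where ab: "e = (a, b)" by (cases e)
      then have "a \<in> f ` X" "b \<in> f ` X" using e assms(3,4) by auto
      then show ?thesis using that ab by auto
    qed
    then have "u \<rightarrow> v" using arcs_iff e by simp
    then obtain e' where "e' \<in> arcs G" "tail G e' = u" "head G e' = v"
      by (auto simp: arcs_ends_def arc_to_ends_def)
    then have "e' \<in> arcs (G \<restriction> X)" and "e = iso_arcs h e'"
      using uv by (simp_all add: h_def)
    then show "e \<in> iso_arcs h ` arcs (G \<restriction> X)" by simp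
  qed
  ultimately show ?thesis
    using assms(3) unfolding digraph_iso_def
    by (intro exI[of _ h]) (simp add: app_iso_def h_def with_proj_def)
qed

lemma (in digraph) not_induced_free_with_proj:
  assumes "X \<subseteq> verts G" and "inj_on f X" and "f ` X = pverts P"
    and "parcs P \<subseteq> pverts P \<times> pverts P"
    and "\<forall>u\<in>X. \<forall>v\<in>X. u \<rightarrow> v \<longleftrightarrow> (f u, f v) \<in> parcs P"
  shows "\<not> induced_free G (with_proj P)"
  using induced_iso_with_proj[OF assms] assms(1) by (auto simp: induced_free_def)

text \<open>A walk of at most two arcs from outside \<open>Q\<close> into \<open>Q\<close> has
  distinct ends, and without loops its middle vertex differs from both, so it is a path.\<close>

lemma (in digraph) quasi_kernel_if_quasi_kernel_on:
  assumes Q: "quasi_kernel_on (\<lambda>u v. u \<rightarrow> v) (verts G) Q"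
  shows "quasi_kernel G Q"
  unfolding quasi_kernel_def
proof (intro conjI ballI)
  show "independent_set G Q"
    using Q by (auto simp: quasi_kernel_on_def independent_set_def)
next
  fix v assume v: "v \<in> verts G - Q"
  then obtain u where u: "u \<in> Q" "v \<rightarrow> u \<or> (\<exists>x\<in>verts G. v \<rightarrow> x \<and> x \<rightarrow> u)"
    using Q unfolding quasi_kernel_on_def by blast
  have "\<exists>p. apath v p u \<and> (length p = 1 \<or> length p = 2)"
    using u(2)
  proof
    assume "v \<rightarrow> u"
    then obtain e where "e \<in> arcs G" "tail G e = v" "head G e = u"
      by (auto simp: arcs_ends_def arc_to_ends_def)
    then have "apath v [e] u"
      using u(1) v by (auto simp: apath_Cons_iff apath_Nil_iff)
    then show ?thesis by force
  next
    assume "\<exists>x\<in>verts G. v \<rightarrow> x \<and> x \<rightarrow> u"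
    then obtain d e where "d \<in> arcs G" "tail G d = v" "e \<in> arcs G"
      "tail G e = head G d" "head G e = u"
      by (auto simp: arcs_ends_def arc_to_ends_def)
    moreover from this have "tail G d \<noteq> head G d" "tail G e \<noteq> head G e"
      using no_loops by auto
    ultimately have "apath v [d, e] u"
      using u(1) v by (auto simp: apath_Cons_iff apath_Nil_iff)
    then show ?thesis by force
  qed
  with u(1) show "\<exists>u\<in>Q. \<exists>p. apath v p u \<and> (length p = 1 \<or> length p = 2)" by blast
qed

theorem theorem2:
  fixes D :: "('a,'b) pre_digraph"
  assumes "digraph D"
    and "sink_free D"
    and "induced_free D K41"
    and "induced_free D K41_plus"
  shows "\<exists>Q. quasi_kernel D Q \<and> real (card Q) \<le> real (card (verts D)) / 2"
proof -
  interpret digraph D by fact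
  have "sink_free_no_in_claw (\<lambda>u v. u \<rightarrow>\<^bsub>D\<^esub> v) (verts D)"
  proof
    show "\<forall>v\<in>verts D. \<not> v \<rightarrow>\<^bsub>D\<^esub> v"
      using no_loops by (force simp: arcs_ends_def arc_to_ends_def)
    then have irrefl: "\<And>v. v \<in> verts D \<Longrightarrow> \<not> v \<rightarrow>\<^bsub>D\<^esub> v" by blast
    show "\<exists>w\<in>verts D. v \<rightarrow>\<^bsub>D\<^esub> w" if "v \<in> verts D" for v
      using assms(2) that by (auto simp: sink_free_def sink_def)
    fix c a1 a2 a3 a4
    \<comment> \<open>Labels the five vertices as in \<open>K41\<close>; the default value 4 is the
      label of \<open>a4\<close>.\<close>
    define f :: "'a \<Rightarrow> nat" where
      "f x = (if x = c then 0 else if x = a1 then 1 else if x = a2 then 2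
              else if x = a3 then 3 else 4)" for x
    assume V: "{c, a1, a2, a3, a4} \<subseteq> verts D" and dist: "distinct [c, a1, a2, a3, a4]"
      and claw: "\<forall>x\<in>{a1, a2, a3, a4}. x \<rightarrow>\<^bsub>D\<^esub> c \<and> \<not> c \<rightarrow>\<^bsub>D\<^esub> x"
    have f: "f c = 0" "f a1 = 1" "f a2 = 2" "f a3 = 3" "f a4 = 4"
      using dist by (auto simp: f_def)
    have inj: "inj_on f {c, a1, a2, a3, a4}"
      using f by (simp add: inj_on_def)
    have img: "f ` {c, a1, a2, a3, a4} = {0, 1, 2, 3, 4}"
      using f by simp
    {
      assume "\<forall>x\<in>{a1, a2, a3, a4}. \<forall>y\<in>{a1, a2, a3, a4}. \<not> x \<rightarrow>\<^bsub>D\<^esub> y"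
      then have "\<not> induced_free D K41"
        unfolding K41_def using V claw f img irrefl
        by (intro not_induced_free_with_proj[OF V inj]) auto
      with assms(3) show False by simp
    next
      assume "\<forall>x\<in>{a1, a2, a3, a4}. \<forall>y\<in>{a1, a2, a3, a4}. x \<rightarrow>\<^bsub>D\<^esub> y \<longleftrightarrow> x = a1 \<and> y = a2"
      then have "\<not> induced_free D K41_plus"
        unfolding K41_plus_eq using V claw f img irrefl dist
        by (intro not_induced_free_with_proj[OF V inj]) auto
      with assms(4) show False by simp
    }
  qed simp
  then obtain Q where "quasi_kernel_on (\<lambda>u v. u \<rightarrow>\<^bsub>D\<^esub> v) (verts D) Q" "2 * card Q \<le> card (verts D)"
    using sink_free_no_in_claw.small_quasi_kernel by blast
  then show ?thesis
    using quasi_kernel_if_quasi_kernel_on by (intro exI[of _ Q]) auto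
qed

end
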